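(* Let $\le$ be the product (coordinatewise) order on $\mathbb N^{\mathbb N}$, and let $\le^*$ be the eventual dominance relation on $\mathbb N^{\mathbb N}$. Then $(\mathbb N^{\mathbb N},\le^* )$ is the transitive augmentation of the $\mathrm{proj}$-strictive augmentation of $(\mathbb N^{\mathbb N},\le)$; that is, $\le^*$ equals $\bigl(\le^{\mathrm{str}}_{\mathrm{proj}}\bigr)^{\mathrm{tran}}$.
   Context: $\mathbb N=\{0,1,2,\dots\}$ with its usual order; $\mathbb N^{\mathbb N}$ is the set of all functions $\mathbb N\to\mathbb N$. $x\le y$ means $x(n)\le y(n)$ for all $n\in\mathbb N$; $x\le^* y$ means $x(n)\le y(n)$ for all but finitely many $n\in\mathbb N$. For $h:\mathbb N\to\mathbb N$, $\pi_h:\mathbb N^{\mathbb N}\to\mathbb N^{\mathbb N}$ is the map $\pi_h(x)=x\circ h$, and $\mathrm{proj}=\{\pi_h : h:\mathbb N\to\mathbb N\text{ is injective}\}$. For a binary relation $\le$ on a set $S$, $p<q$ means $p\le q$ and $q\nleq p$. For a family $\Theta$ of functions from $S$ to $S$, the $\Theta$-strictive augmentation $\le^{\mathrm{str}}_{\Theta}$ of $\le$ is defined by: $p\le^{\mathrm{str}}_{\Theta}q$ if and only if $p\le q$, or ($q<p$ and for every $\sigma\in\Theta$ there is $\tau\in\Theta$ such that it is not the case that $\tau(\sigma(q))<\tau(\sigma(p))$). The transitive augmentation $\preceq^{\mathrm{tran}}$ of a relation $\preceq$ on $S$ is its transitive closure: $p\preceq^{\mathrm{tran}}q$ iff there is a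 finite sequence $p=p_0\preceq p_1\preceq\cdots\preceq p_{n-1}=q$ in $S$. *)

theory Defs
  imports Main
begin

definition strict_part :: "('a \<Rightarrow> 'a \<Rightarrow> bool) \<Rightarrow> 'a \<Rightarrow> 'a \<Rightarrow> bool" where
  "strict_part R p q \<longleftrightarrow> R p q \<and> \<not> R q p"

definition strictive_aug ::
    "('a \<Rightarrow> 'a) set \<Rightarrow> ('a \<Rightarrow> 'a \<Rightarrow> bool) \<Rightarrow> 'a \<Rightarrow> 'a \<Rightarrow> bool" where
  "strictive_aug \<Theta> R p q \<longleftrightarrow>
     R p q \<or>
     (strict_part R q p \<and>
      (\<forall>\<sigma>\<in>\<Theta>. \<exists>\<tau>\<in>\<Theta>. \<not> strict_part R (\<tau> (\<sigma> q)) (\<tau> (\<sigma> p))))"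

text \<open>
  Closure under chains of at least one step. A one-element chain, which would add reflexivity,
  is not counted; for augmentations of a reflexive relation this makes no difference.
\<close>
definition transitive_aug :: "('a \<Rightarrow> 'a \<Rightarrow> bool) \<Rightarrow> 'a \<Rightarrow> 'a \<Rightarrow> bool" where
  "transitive_aug R = R\<^sup>+\<^sup>+"

definition reindex :: "(nat \<Rightarrow> nat) \<Rightarrow> (nat \<Rightarrow> nat) \<Rightarrow> (nat \<Rightarrow> nat)" where
  "reindex h x = x \<circ> h"

definition proj :: "((nat \<Rightarrow> nat) \<Rightarrow> (nat \<Rightarrow> nat)) set" where
  "proj = {reindex h | h. inj h}"

definition eventually_le :: "(nat \<Rightarrow> nat) \<Rightarrow> (nat \<Rightarrow> nat) \<Rightarrow> bool" where
  "eventually_le x y \<longleftrightarrow> (\<forall>\<^sub>\<infinity>n. x n \<le> y n)"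

end

theory Submission
  imports Defs "HOL-Library.Infinite_Set"
begin

text \<open>
  If \<open>q \<le> p\<close>, then \<open>q \<circ> h \<circ> k < p \<circ> h \<circ> k\<close> fails exactly when \<open>p\<close> and \<open>q\<close> agree on the range of
  \<open>h \<circ> k\<close>. Such a \<open>k\<close> exists for every \<open>h\<close> iff \<open>D = {n. q n < p n}\<close> is finite: a shift avoids a finite
  \<open>D\<close>, and the enumeration of an infinite \<open>D\<close> defeats every \<open>k\<close>. So the strictive augmentation adds
  precisely the relations \<open>p \<le>\<^sup>* q\<close> with \<open>q \<le> p\<close>, and \<open>p \<le> max p q \<le>\<^sup>* q\<close> recovers the rest by
  transitivity.
\<close>

lemma strictive_aug_proj_iff:
  fixes p q :: "nat \<Rightarrow> nat"
  shows "strictive_aug proj (\<le>) p q \<longleftrightarrow> p \<le> q \<or> q \<le> p \<and> eventually_le p q"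
proof (cases "p \<le> q")
  case True
  then show ?thesis by (simp add: strictive_aug_def)
next
  case npq: False
  show ?thesis
  proof (cases "q \<le> p")
    case False
    with npq show ?thesis by (simp add: strictive_aug_def strict_part_def)
  next
    case qp: True
    define D where "D = {n. \<not> p n \<le> q n}"
    have ev: "eventually_le p q \<longleftrightarrow> finite D"
      by (simp add: eventually_le_def eventually_cofinite D_def)
    \<comment> \<open>Reindexing preserves \<open>q \<le> p\<close>, so the order is strict as soon
      as the composites differ at one index.\<close>
    have strict: "strict_part (\<le>) (reindex k (reindex h q)) (reindex k (reindex h p))
        \<longleftrightarrow> (\<exists>n. h (k n) \<in> D)" for h k
      using qp by (auto simp: strict_part_def reindex_def D_def le_fun_def)
    \<comment> \<open>In image form, quantifiers over \<open>proj\<close> simplify to quantifiers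
      over injections.\<close>
    have proj_image: "proj = reindex ` {h. inj h}"
      by (auto simp: proj_def)
    have "strictive_aug proj (\<le>) p q
        \<longleftrightarrow> (\<forall>h :: nat \<Rightarrow> nat. inj h \<longrightarrow> (\<exists>k :: nat \<Rightarrow> nat. inj k \<and> (\<forall>n. h (k n) \<notin> D)))"
      using npq qp by (simp add: strictive_aug_def strict_part_def[of _ q p] proj_image strict)
    also have "\<dots> \<longleftrightarrow> finite D"
    proof
      assume avoid: "\<forall>h :: nat \<Rightarrow> nat. inj h \<longrightarrow> (\<exists>k :: nat \<Rightarrow> nat. inj k \<and> (\<forall>n. h (k n) \<notin> D))"
      show "finite D"
      proof (rule ccontr)
        assume inf: "infinite D"
        \<comment> \<open>As \<open>h\<close>, this injection takes all its values in
          \<open>D\<close>, so any \<open>k\<close> already fails at any single index.\<close>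
        then have "inj (enumerate D)"
          by (simp add: strict_mono_enumerate strict_mono_imp_inj_on)
        with avoid inf show False
          by (meson enumerate_in_set)
      qed
    next
      assume fin: "finite D"
      show "\<forall>h :: nat \<Rightarrow> nat. inj h \<longrightarrow> (\<exists>k :: nat \<Rightarrow> nat. inj k \<and> (\<forall>n. h (k n) \<notin> D))"
      proof (intro allI impI)
        fix h :: "nat \<Rightarrow> nat"
        assume "inj h"
        \<comment> \<open>Injectivity of \<open>h\<close> leaves only finitely many indices to skip;
          a shift by a strict bound \<open>m\<close> passes them all.\<close>
        then have "finite (h -` D)"
          using fin by (rule finite_vimageI[rotated])
        then obtain m where "\<forall>n\<in>h -` D. n < m"
          by (auto simp: finite_nat_set_iff_bounded)
        then have "\<forall>n. h (n + m) \<notin> D"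
          by (metis not_add_less2 vimageI)
        then show "\<exists>k :: nat \<Rightarrow> nat. inj k \<and> (\<forall>n. h (k n) \<notin> D)"
          by (intro exI[of _ "\<lambda>n. n + m"]) simp
      qed
    qed
    finally show ?thesis using npq qp ev by simp
  qed
qed

lemma eventually_le_if_le: "p \<le> q \<Longrightarrow> eventually_le p q"
  by (simp add: eventually_le_def le_fun_def)

lemma eventually_le_trans: "eventually_le p q \<Longrightarrow> eventually_le q r \<Longrightarrow> eventually_le p r"
  unfolding eventually_le_def by (erule (1) eventually_elim2) (rule order_trans)

theorem theorem4p18:
  "eventually_le = transitive_aug (strictive_aug proj ((\<le>) :: (nat \<Rightarrow> nat) \<Rightarrow> (nat \<Rightarrow> nat) \<Rightarrow> bool))"
proof (intro ext iffI)
  fix p q :: "nat \<Rightarrow> nat"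
  assume pq: "eventually_le p q"
  let ?r = "\<lambda>n. max (p n) (q n)"
  \<comment> \<open>\<open>max (p n) (q n) \<le> q n\<close> holds exactly where
    \<open>p n \<le> q n\<close>.\<close>
  have "eventually_le ?r q"
    using pq by (simp add: eventually_le_def)
  then have "strictive_aug proj (\<le>) p ?r" "strictive_aug proj (\<le>) ?r q"
    by (simp_all add: strictive_aug_proj_iff le_fun_def)
  then show "transitive_aug (strictive_aug proj (\<le>)) p q"
    unfolding transitive_aug_def by (meson tranclp.intros)
next
  fix p q :: "nat \<Rightarrow> nat"
  assume "transitive_aug (strictive_aug proj (\<le>)) p q"
  then have "(strictive_aug proj (\<le>))\<^sup>+\<^sup>+ p q"
    by (simp add: transitive_aug_def)
  then show "eventually_le p q"
    by (induction rule: tranclp_induct)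
      (auto simp: strictive_aug_proj_iff intro: eventually_le_if_le eventually_le_trans)
qed

end
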